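(* Let $r\geq 1$ and $K$ be integers. (i) If $K\geq r+1$, then for every real $u>0$, $$\sum_{\substack{k_0+k_1+\cdots+k_r=K\\ k_0,k_1,\dots,k_r\geq 1}}\ \sum_{n_1\geq\cdots\geq n_r\geq 1}\frac{1}{(n_1+u-1)^{k_0}(n_1+u)^{k_1}(n_2+u)^{k_2}\cdots(n_r+u)^{k_r}}=\frac{1}{u^{K-r}}.$$ (ii) For every integer $m\geq 2$, $$\sum_{\substack{k_1+\cdots+k_r=K\\ k_1\geq 2,\ k_2,\dots,k_r\geq 1}}(k_1-1)\sum_{n_1\geq n_2\geq\cdots\geq n_r\geq m}\frac{1}{n_1^{k_1}n_2^{k_2}\cdots n_r^{k_r}}<\frac{1}{(m-1)^{K-r}}.$$
   Context: All summation indices $k_i$ and $n_i$ are integers; the outer sums are finite sums over tuples of positive integers with the indicated constraints (an empty sum is $0$). *)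

theory Defs
  imports "HOL-Analysis.Analysis"
begin

text \<open>Tuples are extensional functions on an interval of indices, so that each tuple is
  represented by exactly one function.\<close>

definition compositions :: "nat set \<Rightarrow> int \<Rightarrow> (nat \<Rightarrow> nat) set" where
  "compositions I K = {k \<in> I \<rightarrow>\<^sub>E {1..}. int (\<Sum>i\<in>I. k i) = K}"

text \<open>Tuples \<open>n\<^sub>1 \<ge> n\<^sub>2 \<ge> \<dots> \<ge> n\<^sub>r \<ge> m\<close>.\<close>

definition decreasing_tuples :: "nat \<Rightarrow> nat \<Rightarrow> (nat \<Rightarrow> nat) set" where
  "decreasing_tuples r m = {n \<in> {1..r} \<rightarrow>\<^sub>E {m..}. antimono_on {1..r} n}"

text \<open>An outer sum over compositions is a genuine finite sum.\<close>

lemma finite_compositions: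
  assumes "finite I"
  shows "finite (compositions I K)"
proof (rule finite_subset)
  show "compositions I K \<subseteq> I \<rightarrow>\<^sub>E {..nat K}"
  proof
    fix k assume "k \<in> compositions I K"
    then have k: "k \<in> I \<rightarrow>\<^sub>E {1..}" "(\<Sum>i\<in>I. k i) = nat K"
      by (auto simp: compositions_def simp flip: of_nat_sum)
    then have "k i \<le> nat K" if "i \<in> I" for i
      using member_le_sum[of i I k] assms that by simp
    then show "k \<in> I \<rightarrow>\<^sub>E {..nat K}"
      using k(1) by (auto simp: PiE_iff)
  qed
  show "finite (I \<rightarrow>\<^sub>E {..nat K})"
    using assms by (intro finite_PiE) auto
qed

end

theory Submission
  imports Defs
begin

text \<open>For \<open>x = n\<^sub>1 + u - 1\<close> and fixed \<open>k\<^sub>0 + k\<^sub>1 = q\<close>, the geometric sum of \<open>1 / (x^k\<^sub>0 (x + 1)^k\<^sub>1)\<close>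
  equals \<open>1 / x^(q - 1) - 1 / (x + 1)^(q - 1)\<close>, which telescopes over \<open>n\<^sub>1 \<ge> n\<^sub>2\<close> to
  \<open>1 / (n\<^sub>2 + u - 1)^(q - 1)\<close>. So the sum for \<open>r\<close> and \<open>K\<close> is the sum for the indices \<open>2, \<dots>, r\<close>
  and \<open>K - 1\<close>, with \<open>q - 1\<close> as the new \<open>k\<^sub>0\<close>; after \<open>r\<close> steps only \<open>1 / u^(K - r)\<close> is left.
  Part (ii) follows from part (i) at \<open>u = m - 1\<close>, since replacing the factors \<open>n\<^sub>1 - 1\<close> by \<open>n\<^sub>1\<close>
  makes the \<open>q - 1\<close> terms with \<open>k\<^sub>0 + k\<^sub>1 = q\<close> coincide and strictly decreases them.\<close>

text \<open>The lower end \<open>s\<close> varies because the induction removes the entry of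
  smallest index; \<open>s = 1\<close> gives \<open>decreasing_tuples\<close>.\<close>

definition dec_tuples :: "nat \<Rightarrow> nat \<Rightarrow> nat \<Rightarrow> (nat \<Rightarrow> nat) set" where
  "dec_tuples s r m = {n \<in> {s..r} \<rightarrow>\<^sub>E {m..}. antimono_on {s..r} n}"

text \<open>The convention \<open>n\<^sub>r\<^sub>+\<^sub>1 = m\<close> lets the induction start from the empty tuple.\<close>

definition head :: "nat \<Rightarrow> nat \<Rightarrow> nat \<Rightarrow> (nat \<Rightarrow> nat) \<Rightarrow> nat" where
  "head s r m n = (if s \<le> r then n s else m)"

text \<open>Index 0 carries the exponent of the shifted factor for every \<open>s\<close>; at
  \<open>s = r + 1\<close> only \<open>1 / (m + c - 1) ^ k 0\<close> is left. Part (i) takes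
  \<open>c = u\<close> and \<open>m = 1\<close>, part (ii) takes \<open>c = 0\<close>.\<close>

definition summand :: "real \<Rightarrow> nat \<Rightarrow> nat \<Rightarrow> nat \<Rightarrow> (nat \<Rightarrow> nat) \<Rightarrow> (nat \<Rightarrow> nat) \<Rightarrow> real" where
  "summand c s r m k n =
     1 / ((real (head s r m n) + c - 1) ^ k 0 * (\<Prod>i=s..r. (real (n i) + c) ^ k i))"

section \<open>Geometric sum and telescoping series\<close>

lemma sum_inverse_powers_telescope:
  fixes x :: real
  assumes "x > 0" "q \<ge> 1"
  shows "(\<Sum>j=1..<q. 1 / (x ^ j * (x + 1) ^ (q - j))) = 1 / x ^ (q - 1) - 1 / (x + 1) ^ (q - 1)"
  using assms(2)
proof (induction q rule: dec_induct)
  case base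
  then show ?case by simp
next
  case (step q)
  \<comment> \<open>From \<open>q\<close> to \<open>Suc q\<close> each old term gains a factor
    \<open>1 / (x + 1)\<close>, and the term \<open>j = q\<close> is new.\<close>
  have "(\<Sum>j=1..<Suc q. 1 / (x ^ j * (x + 1) ^ (Suc q - j)))
      = (\<Sum>j=1..<q. 1 / (x ^ j * (x + 1) ^ (q - j)) / (x + 1)) + 1 / (x ^ q * (x + 1))"
    using step(1) by (auto intro!: sum.cong simp: Suc_diff_le mult.commute)
  also have "\<dots> = (1 / x ^ (q - 1) - 1 / (x + 1) ^ (q - 1)) / (x + 1) + 1 / (x ^ q * (x + 1))"
    unfolding sum_divide_distrib[symmetric] step.IH ..
  also have "\<dots> = 1 / x ^ q - 1 / (x + 1) ^ q"
    using step(1) assms(1) by (cases q) (auto simp: divide_simps, auto simp: algebra_simps)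
  finally show ?case by simp
qed

text \<open>Since \<open>p \<ge> 1\<close>, the inverse powers tend to 0 and only the boundary term
  at \<open>t\<close> survives.\<close>

lemma telescope_inverse_powers_has_sum:
  fixes c :: real
  assumes "real t + c - 1 > 0" "p \<ge> 1"
  shows "((\<lambda>a. 1 / (real a + c - 1) ^ p - 1 / (real a + c) ^ p) has_sum
           1 / (real t + c - 1) ^ p) {t..}"
proof -
  define f where "f i = 1 / (real (t + i) + c - 1) ^ p" for i
  have "f \<longlonglongrightarrow> 0"
    unfolding f_def
  proof (intro tendsto_divide_0[OF tendsto_const] filterlim_at_top_imp_at_infinity filterlim_pow_at_top)
    have "filterlim (\<lambda>i. (real t + c - 1) + real i) at_top sequentially"
      by (intro filterlim_tendsto_add_at_top[OF tendsto_const] filterlim_real_sequentially)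
    then show "filterlim (\<lambda>i. real (t + i) + c - 1) at_top sequentially"
      by (simp add: algebra_simps)
  qed (use assms(2) in auto)
  then have "(\<lambda>i. f i - f (Suc i)) sums (f 0 - 0)"
    by (rule telescope_sums')
  \<comment> \<open>Nonnegative terms turn the ordered series into the unordered sum that
    \<open>has_sum\<close> asks for.\<close>
  moreover have "f i - f (Suc i) \<ge> 0" for i
    unfolding f_def using assms by (auto intro!: divide_left_mono power_mono)
  ultimately have "((\<lambda>i. f i - f (Suc i)) has_sum f 0) UNIV"
    by (intro sums_nonneg_imp_has_sum) auto
  also have "(\<lambda>i. f i - f (Suc i)) = (\<lambda>a. 1 / (real a + c - 1) ^ p - 1 / (real a + c) ^ p) \<circ> (+) t"
    by (auto simp: f_def fun_eq_iff algebra_simps)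
  finally have "((\<lambda>a. 1 / (real a + c - 1) ^ p - 1 / (real a + c) ^ p) has_sum f 0) ((+) t ` {0..})"
    by (intro has_sum_reindex[THEN iffD2]) (simp_all only: inj_on_add atLeast_0)
  then show ?thesis
    by (simp only: image_add_atLeast f_def add_0_right)
qed

section \<open>Merging and moving entries of compositions\<close>

lemma compositions_insert_iff:
  assumes "finite J" "a \<notin> J"
  shows "k \<in> compositions (insert a J) K \<longleftrightarrow>
           1 \<le> k a \<and> k(a := undefined) \<in> compositions J (K - int (k a))"
proof -
  have "(\<Sum>i\<in>J. (k(a := undefined)) i) = (\<Sum>i\<in>J. k i)"
    using assms by (intro sum.cong) auto
  then show ?thesis
    using assms unfolding compositions_def PiE_iff extensional_def mem_Collect_eq
    by (auto simp flip: of_nat_sum)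
qed

lemma compositions_outside:
  "k \<in> compositions J K \<Longrightarrow> a \<notin> J \<Longrightarrow> k(a := undefined) = k"
  by (auto simp: compositions_def PiE_iff extensional_def fun_eq_iff)

text \<open>Grouping by the merged entry \<open>q = k a + k s\<close>, stored at \<open>s\<close>:
  both parts are positive, so \<open>q \<ge> 2\<close> and \<open>k a\<close> runs through
  \<open>1..<q\<close>.\<close>

lemma sum_compositions_split:
  assumes "finite J" "a \<notin> J" "s \<notin> J" "a \<noteq> s"
  shows "(\<Sum>k\<in>compositions (insert a (insert s J)) K. F k)
       = (\<Sum>k | k \<in> compositions (insert s J) K \<and> k s \<ge> 2.
            \<Sum>j=1..<k s. F (k(a := j, s := k s - j)))"
proof -
  have fin: "finite {k \<in> compositions (insert s J) K. k s \<ge> 2}"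
    using finite_compositions[of "insert s J" K] assms(1) by simp
  have out: "k(a := undefined) = k" if "k \<in> compositions (insert s J) K" for k
    using compositions_outside[OF that, of a] assms by simp
  have mem: "k \<in> compositions (insert a (insert s J)) K \<longleftrightarrow>
      1 \<le> k a \<and> 1 \<le> k s \<and> k(a := undefined, s := undefined) \<in> compositions J (K - int (k a + k s))" for k
    using assms by (simp add: compositions_insert_iff algebra_simps conj_assoc)
  have "(\<Sum>k\<in>compositions (insert a (insert s J)) K. F k)
      = (\<Sum>(k, j)\<in>(SIGMA k:{k \<in> compositions (insert s J) K. k s \<ge> 2}. {1..<k s}).
           F (k(a := j, s := k s - j)))"
  \<comment> \<open>The forward map merges the two entries at \<open>s\<close> and records the old
    \<open>k a\<close>; position \<open>a\<close> is reset to \<open>undefined\<close> to keep the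
    tuple extensional.\<close>
  proof (rule sum.reindex_bij_witness
      [where j = "\<lambda>k. (k(a := undefined, s := k s + k a), k a)"
         and i = "\<lambda>(k, j). k(a := j, s := k s - j)"], goal_cases)
    case (1 k)
    then show ?case using assms by (auto simp: fun_eq_iff)
  next
    case (2 k)
    then show ?case using assms
      by (auto simp: mem compositions_insert_iff fun_upd_twist add.commute)
  next
    case (3 p)
    then obtain k j where p: "p = (k, j)" "k \<in> compositions (insert s J) K" "j < k s"
      by auto
    then show ?case using assms out[OF p(2)] by (auto simp: fun_upd_twist)
  next
    case (4 p)
    then obtain k j where p: "p = (k, j)" "k \<in> compositions (insert s J) K" "j < k s" "1 \<le> j"
      by auto
    moreover have "k(a := undefined, s := undefined) = k(s := undefined)"
      using out[OF p(2)] by simp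
    ultimately show ?case using assms
      by (auto simp: mem compositions_insert_iff fun_upd_twist[of a s])
  next
    case (5 p)
    then show ?case using assms by (auto simp: fun_eq_iff intro!: arg_cong[of _ _ F])
  qed
  also have "\<dots> = (\<Sum>k | k \<in> compositions (insert s J) K \<and> k s \<ge> 2.
            \<Sum>j=1..<k s. F (k(a := j, s := k s - j)))"
    using fin by (subst sum.Sigma) auto
  finally show ?thesis .
qed

text \<open>Moving an entry \<open>k s \<ge> 2\<close> to position \<open>a\<close> and lowering it
  by 1 is a bijection onto the compositions of \<open>K - 1\<close>. With \<open>a = 0\<close> it
  turns \<open>q - 1\<close> into the new \<open>k 0\<close>.\<close>

lemma sum_compositions_shift:
  assumes "finite J" "a \<notin> J" "s \<notin> J" "a \<noteq> s"
  shows "(\<Sum>k\<in>compositions (insert a J) (K - 1). F k)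
       = (\<Sum>k | k \<in> compositions (insert s J) K \<and> k s \<ge> 2. F (k(a := k s - 1, s := undefined)))"
proof (rule sum.reindex_bij_witness
      [where j = "\<lambda>k. k(s := k a + 1, a := undefined)"
         and i = "\<lambda>k. k(a := k s - 1, s := undefined)"], goal_cases)
  case (1 k)
  then show ?case
    using assms compositions_outside[OF 1, of s] by (simp add: fun_eq_iff)
next
  case (2 k)
  then have "k(s := undefined) = k"
    using assms compositions_outside[OF 2, of s] by simp
  with 2 show ?case using assms
    by (auto simp: compositions_insert_iff fun_upd_twist[of a s] algebra_simps)
next
  case (3 k)
  then show ?case
    using assms compositions_outside[of k "insert s J" K a] by (simp add: fun_eq_iff)
next
  case (4 k)
  then have "k(a := undefined) = k"
    using assms compositions_outside[of k "insert s J" K a] by simp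
  then have "k(s := undefined, a := undefined) = k(s := undefined)"
    using assms(4) by (simp add: fun_upd_twist[of s a])
  with 4 show ?case using assms
    by (auto simp: compositions_insert_iff algebra_simps of_nat_diff)
next
  case (5 k)
  then show ?case
    using assms compositions_outside[OF 5, of s]
    by (intro arg_cong[of _ _ F]) (auto simp: fun_eq_iff split: if_splits)
qed

section \<open>Summing out the first entry of a tuple\<close>

lemma summand_fun_upd:
  assumes "s \<le> r"
  shows "summand c s r m k (n(s := a)) =
     1 / ((real a + c - 1) ^ k 0 * (real a + c) ^ k s) * (1 / (\<Prod>i=Suc s..r. (real (n i) + c) ^ k i))"
  using assms by (simp add: summand_def head_def prod.atLeast_Suc_atMost)

text \<open>\<open>sum_compositions_split\<close> groups by \<open>k 0 + k s = q\<close>, the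
  geometric sum with \<open>x = a + c - 1\<close> evaluates each group, and
  \<open>sum_compositions_shift\<close> reads \<open>q - 1\<close> as the new
  \<open>k 0\<close>.\<close>

lemma sum_summand_fun_upd:
  fixes c :: real
  assumes s: "1 \<le> s" "s \<le> r" and a: "real a + c - 1 > 0"
  shows "(\<Sum>k\<in>compositions (insert 0 {s..r}) K. summand c s r m k (n(s := a)))
       = (\<Sum>k\<in>compositions (insert 0 {Suc s..r}) (K - 1).
            (1 / (real a + c - 1) ^ k 0 - 1 / (real a + c) ^ k 0)
              * (1 / (\<Prod>i=Suc s..r. (real (n i) + c) ^ k i)))"
    (is "_ = (\<Sum>k\<in>_. ?G k * (1 / ?P k))")
proof -
  have P: "?P (k(0 := x, s := y)) = ?P k" for k x y
    using s by (intro prod.cong) auto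
  have "(\<Sum>j=1..<k s. summand c s r m (k(0 := j, s := k s - j)) (n(s := a)))
      = ?G (k(0 := k s - 1, s := undefined)) * (1 / ?P (k(0 := k s - 1, s := undefined)))"
    if "k s \<ge> 2" for k
    using sum_inverse_powers_telescope[OF a, of "k s"] s that
    unfolding summand_fun_upd[OF s(2)] P sum_distrib_right[symmetric] by simp
  moreover have "{s..r} = insert s {Suc s..r}"
    using s by auto
  ultimately show ?thesis
    using s by (subst sum_compositions_shift[where s = s]) (auto simp: sum_compositions_split)
qed

lemma has_sum_finite_sum:
  fixes f :: "'a \<Rightarrow> 'b \<Rightarrow> 'c :: topological_comm_monoid_add"
  assumes "\<And>i. i \<in> I \<Longrightarrow> (f i has_sum S i) A"
  shows "((\<lambda>x. \<Sum>i\<in>I. f i x) has_sum (\<Sum>i\<in>I. S i)) A"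
  using assms by (induction I rule: infinite_finite_induct) (auto intro: has_sum_0 has_sum_add)

lemma head_ge: "n \<in> dec_tuples s r m \<Longrightarrow> m \<le> head s r m n"
  by (auto simp: dec_tuples_def head_def PiE_iff)

lemma summand_nonneg:
  assumes "n \<in> dec_tuples s r m" "real m + c - 1 > 0"
  shows "summand c s r m k n \<ge> 0"
proof -
  have "real (n i) + c \<ge> 0" if "i \<in> {s..r}" for i
  proof -
    have "m \<le> n i"
      using assms that by (auto simp: dec_tuples_def PiE_iff)
    with assms(2) show ?thesis by linarith
  qed
  moreover have "real (head s r m n) + c - 1 \<ge> 0"
    using head_ge[OF assms(1)] assms(2) by linarith
  ultimately show ?thesis
    unfolding summand_def
    by (intro divide_nonneg_nonneg mult_nonneg_nonneg prod_nonneg zero_le_power) auto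
qed

text \<open>Together with \<open>dec_tuples_tail\<close> this identifies tuples from
  \<open>s\<close> on with pairs of a tail and an entry at least the head of the tail; the
  convention in \<open>head\<close> covers the empty tail.\<close>

lemma fun_upd_mem_dec_tuples:
  assumes "s \<le> r" "n \<in> dec_tuples (Suc s) r m" "head (Suc s) r m n \<le> a"
  shows "n(s := a) \<in> dec_tuples s r m"
proof -
  have a: "n i \<le> a" if "Suc s \<le> i" "i \<le> r" for i
  proof -
    have "n i \<le> n (Suc s)"
      using assms(2) that by (auto simp: dec_tuples_def monotone_on_def)
    with assms(3) that show ?thesis by (simp add: head_def)
  qed
  moreover have "m \<le> a"
    using head_ge[OF assms(2)] assms(3) by linarith
  ultimately show ?thesis
    using assms(1,2) unfolding dec_tuples_def monotone_on_def
    by (auto simp: PiE_iff extensional_def)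
qed

lemma dec_tuples_tail:
  assumes "s \<le> r" "n \<in> dec_tuples s r m"
  shows "n(s := undefined) \<in> dec_tuples (Suc s) r m"
    and "head (Suc s) r m (n(s := undefined)) \<le> n s"
  using assms by (auto simp: dec_tuples_def monotone_on_def head_def PiE_iff extensional_def)

text \<open>For a fixed tail, the sum over the entry at \<open>s\<close> telescopes to the summand
  of the tail. Nonnegativity then joins the iterated sums into one sum over all tuples
  (Tonelli).\<close>

lemma sum_summand_has_sum_Suc:
  fixes c :: real
  assumes s: "1 \<le> s" "s \<le> r" and m: "real m + c - 1 > 0"
    and S: "((\<lambda>n. \<Sum>k\<in>compositions (insert 0 {Suc s..r}) (K - 1). summand c (Suc s) r m k n)
              has_sum S) (dec_tuples (Suc s) r m)"
  shows "((\<lambda>n. \<Sum>k\<in>compositions (insert 0 {s..r}) K. summand c s r m k n)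
              has_sum S) (dec_tuples s r m)"
proof -
  define g where "g n = (\<Sum>k\<in>compositions (insert 0 {s..r}) K. summand c s r m k n)" for n
  define h where "h n = (\<Sum>k\<in>compositions (insert 0 {Suc s..r}) (K - 1). summand c (Suc s) r m k n)" for n
  let ?A = "dec_tuples (Suc s) r m" and ?B = "\<lambda>n. {head (Suc s) r m n..}"
  have inner: "((\<lambda>a. g (n(s := a))) has_sum h n) (?B n)" if n: "n \<in> ?A" for n
  proof -
    let ?P = "\<lambda>k. \<Prod>i=Suc s..r. (real (n i) + c) ^ k i"
    have pos: "real a + c - 1 > 0" if "a \<in> ?B n" for a
      using head_ge[OF n] that m by simp
    have "((\<lambda>a. \<Sum>k\<in>compositions (insert 0 {Suc s..r}) (K - 1).
            (1 / (real a + c - 1) ^ k 0 - 1 / (real a + c) ^ k 0) * (1 / ?P k)) has_sum h n) (?B n)"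
      unfolding h_def
    proof (rule has_sum_finite_sum)
      fix k assume k: "k \<in> compositions (insert 0 {Suc s..r}) (K - 1)"
      then have "k 0 \<ge> 1"
        by (simp add: compositions_insert_iff)
      \<comment> \<open>Telescoping starts at the head of the tail, so its value is the shifted
        factor of the next \<open>summand\<close>.\<close>
      from has_sum_cmult_left[OF telescope_inverse_powers_has_sum[OF pos this],
          of "head (Suc s) r m n" "1 / ?P k"]
      show "((\<lambda>a. (1 / (real a + c - 1) ^ k 0 - 1 / (real a + c) ^ k 0) * (1 / ?P k))
              has_sum summand c (Suc s) r m k n) (?B n)"
        by (simp add: summand_def)
    qed
    also have "?this \<longleftrightarrow> ?thesis"
      using s pos by (intro has_sum_cong) (simp only: g_def sum_summand_fun_upd)
    finally show ?thesis .
  qed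
  have nonneg: "g n \<ge> 0" if "n \<in> dec_tuples s r m" for n
    unfolding g_def using that m by (intro sum_nonneg summand_nonneg)
  have S: "(h has_sum S) ?A"
    using S unfolding h_def .
  have "((\<lambda>(n, a). g (n(s := a))) has_sum S) (Sigma ?A ?B)"
  proof (rule has_sum_SigmaI[OF _ S])
    show "(\<lambda>(n, a). g (n(s := a))) summable_on Sigma ?A ?B"
    proof (rule summable_on_SigmaI[where g = h])
      show "h summable_on ?A"
        using S by (rule has_sum_imp_summable)
      show "(case (n, a) of (n, a) \<Rightarrow> g (n(s := a))) \<ge> 0" if "n \<in> ?A" "a \<in> ?B n" for n a
        using that fun_upd_mem_dec_tuples[OF s(2)] by (auto intro: nonneg)
    qed (use inner in simp)
  qed (use inner in simp)
  also have "?this \<longleftrightarrow> (g has_sum S) (dec_tuples s r m)"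
  proof (rule has_sum_reindex_bij_witness
      [where j = "\<lambda>(n, a). n(s := a)" and i = "\<lambda>n. (n(s := undefined), n s)"], goal_cases)
    case (1 p)
    then show ?case by (auto simp: dec_tuples_def PiE_iff extensional_def fun_eq_iff)
  next
    case (2 p)
    then show ?case using fun_upd_mem_dec_tuples[OF s(2)] by auto
  next
    case (4 n)
    then show ?case using dec_tuples_tail[OF s(2)] by auto
  qed auto
  finally show ?thesis
    unfolding g_def .
qed

text \<open>Downward induction on \<open>s\<close> from the empty tuple at \<open>s = r + 1\<close>.
  Passing from \<open>s\<close> to \<open>Suc s\<close> lowers \<open>K\<close> by 1, so the
  exponent \<open>K - int (Suc r - s)\<close> stays the same.\<close>

lemma sum_summand_has_sum:
  fixes c :: real
  assumes "s \<le> Suc r" "1 \<le> s" and m: "real m + c - 1 > 0" and "K \<ge> int (Suc r - s) + 1"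
  shows "((\<lambda>n. \<Sum>k\<in>compositions (insert 0 {s..r}) K. summand c s r m k n)
              has_sum 1 / (real m + c - 1) powi (K - int (Suc r - s))) (dec_tuples s r m)"
  using assms(1,2,4)
proof (induction s arbitrary: K rule: inc_induct)
  case base
  \<comment> \<open>The bound on \<open>K\<close> reads \<open>K \<ge> 1\<close> here, so the single
    entry \<open>nat K\<close> is admissible.\<close>
  have "compositions {0} K = {(\<lambda>_. undefined)(0 := nat K)}"
    using base by (auto simp: compositions_def PiE_iff extensional_def fun_eq_iff)
  moreover have "dec_tuples (Suc r) r m = {\<lambda>_. undefined}"
    by (auto simp: dec_tuples_def monotone_on_def)
  ultimately show ?case
    using base by (simp add: summand_def head_def power_int_def has_sum_finite_iff)
next
  case (step s)
  have "((\<lambda>n. \<Sum>k\<in>compositions (insert 0 {Suc s..r}) (K - 1). summand c (Suc s) r m k n)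
     has_sum 1 / (real m + c - 1) powi (K - 1 - int (Suc r - Suc s))) (dec_tuples (Suc s) r m)"
    using step by (intro step.IH) auto
  also have "K - 1 - int (Suc r - Suc s) = K - int (Suc r - s)"
    using step by (auto simp: of_nat_diff)
  finally have IH: "((\<lambda>n. \<Sum>k\<in>compositions (insert 0 {Suc s..r}) (K - 1). summand c (Suc s) r m k n)
     has_sum 1 / (real m + c - 1) powi (K - int (Suc r - s))) (dec_tuples (Suc s) r m)" .
  show ?case
  proof (rule sum_summand_has_sum_Suc[OF _ _ m IH])
    show "1 \<le> s" "s \<le> r"
      using step.hyps step.prems(1) by simp_all
  qed
qed

section \<open>Return to the original index sets and termwise comparison\<close>

lemma dec_tuples_one: "dec_tuples 1 r m = decreasing_tuples r m"
  by (simp add: dec_tuples_def decreasing_tuples_def)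

text \<open>Each part is at least 1. Part (ii) assumes no lower bound on \<open>K\<close>; this
  supplies one when its outer sum is nonempty.\<close>

lemma compositions_nonempty_imp_ge:
  assumes "finite I" "k \<in> compositions I K"
  shows "int (card I) \<le> K"
proof -
  have "card I \<le> (\<Sum>i\<in>I. k i)"
    using sum_mono[of I "\<lambda>_. 1" k] assms by (auto simp: compositions_def PiE_iff)
  with assms(2) show ?thesis
    by (auto simp: compositions_def simp flip: of_nat_sum)
qed

text \<open>Replacing \<open>(n s - 1) ^ j\<close> by \<open>n s ^ j\<close> enlarges the
  denominator, strictly because \<open>j \<ge> 1\<close>, and the exponents \<open>j\<close> and
  \<open>k s - j\<close> then add up to \<open>k s\<close>. The bound \<open>m \<ge> 2\<close> keeps
  \<open>n s - 1\<close> positive.\<close>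

lemma inverse_prod_less_summand:
  assumes "1 \<le> s" "s \<le> r" "m \<ge> 2" "n \<in> dec_tuples s r m" "1 \<le> j" "j < k s"
  shows "1 / (\<Prod>i=s..r. real (n i) ^ k i) < summand 0 s r m (k(0 := j, s := k s - j)) n"
proof -
  have ge: "n i \<ge> 2" if "s \<le> i" "i \<le> r" for i
    using assms(3,4) that by (force simp: dec_tuples_def PiE_iff)
  define a where "a = real (n s)"
  define P where "P = (\<Prod>i=Suc s..r. real (n i) ^ k i)"
  have P: "P > 0"
    unfolding P_def
  proof (intro prod_pos zero_less_power)
    show "real (n i) > 0" if "i \<in> {Suc s..r}" for i
      using ge[of i] that by simp
  qed
  have a: "a \<ge> 2"
    unfolding a_def using ge[of s] assms(2) by simp
  have "(a - 1) ^ j < a ^ j"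
    using a assms(5) by (intro power_strict_mono) auto
  then have "(a - 1) ^ j * a ^ (k s - j) < a ^ j * a ^ (k s - j)"
    using a by (intro mult_strict_right_mono) auto
  also have "\<dots> = a ^ k s"
    using assms(6) by (simp flip: power_add)
  finally have "1 / a ^ k s * (1 / P) < 1 / ((a - 1) ^ j * a ^ (k s - j)) * (1 / P)"
    using a P by (intro mult_strict_right_mono divide_strict_left_mono mult_pos_pos) auto
  \<comment> \<open>The trivial update \<open>n(s := n s)\<close> makes
    \<open>summand_fun_upd\<close> applicable.\<close>
  also have "\<dots> = summand 0 s r m (k(0 := j, s := k s - j)) (n(s := n s))"
    unfolding summand_fun_upd[OF assms(2)] a_def P_def using assms(1)
    by (auto intro!: prod.cong)
  finally show ?thesis
    using assms(2) by (simp add: a_def P_def prod.atLeast_Suc_atMost)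
qed

section \<open>The identity and the inequality\<close>

theorem theorem1p4:
  fixes r :: nat and K :: int
  assumes "r \<ge> 1"
  shows
    "(K \<ge> int r + 1 \<longrightarrow>
       (\<forall>u::real. u > 0 \<longrightarrow>
         (\<forall>k \<in> compositions {0..r} K.
            (\<lambda>n. 1 / ((real (n 1) + u - 1) ^ k 0 * (\<Prod>i=1..r. (real (n i) + u) ^ k i)))
              summable_on decreasing_tuples r 1) \<and>
         (\<Sum>k \<in> compositions {0..r} K.
            \<Sum>\<^sub>\<infinity>n \<in> decreasing_tuples r 1.
              1 / ((real (n 1) + u - 1) ^ k 0 * (\<Prod>i=1..r. (real (n i) + u) ^ k i)))
          = 1 / u powi (K - int r))) \<and>
     (\<forall>m::nat. m \<ge> 2 \<longrightarrow>
         (\<forall>k \<in> {k \<in> compositions {1..r} K. k 1 \<ge> 2}.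
            (\<lambda>n. 1 / (\<Prod>i=1..r. real (n i) ^ k i)) summable_on decreasing_tuples r m) \<and>
         (\<Sum>k \<in> {k \<in> compositions {1..r} K. k 1 \<ge> 2}.
            (real (k 1) - 1) *
            (\<Sum>\<^sub>\<infinity>n \<in> decreasing_tuples r m. 1 / (\<Prod>i=1..r. real (n i) ^ k i)))
          < 1 / (real m - 1) powi (K - int r))"
proof (intro conjI impI allI)
  fix u :: real
  assume K: "K \<ge> int r + 1" and u: "u > 0"
  let ?D = "decreasing_tuples r 1"
  define f where "f = summand u 1 r 1"
  have f: "f k n = 1 / ((real (n 1) + u - 1) ^ k 0 * (\<Prod>i=1..r. (real (n i) + u) ^ k i))" for k n
    using assms by (simp add: f_def summand_def head_def)
  have "insert 0 {1..r} = {0..r}"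
    by auto
  then have S: "((\<lambda>n. \<Sum>k\<in>compositions {0..r} K. f k n) has_sum 1 / u powi (K - int r)) ?D"
    using sum_summand_has_sum[of 1 r 1 u K] K u assms
    unfolding f_def dec_tuples_one by (simp add: algebra_simps)
  have nonneg: "f k n \<ge> 0" if "n \<in> ?D" for k n
    unfolding f_def using that u by (intro summand_nonneg) (simp_all add: dec_tuples_one del: One_nat_def)
  \<comment> \<open>Each term is dominated by the total over all compositions, which is already
    known to be summable.\<close>
  have *: "f k summable_on ?D" if "k \<in> compositions {0..r} K" for k
    using has_sum_imp_summable[OF S]
  proof (rule summable_on_comparison_test)
    show "f k n \<le> (\<Sum>k\<in>compositions {0..r} K. f k n)" if "n \<in> ?D" for n
      using that \<open>k \<in> _\<close> nonneg by (intro member_le_sum) (auto simp: finite_compositions)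
  qed (use nonneg in auto)
  then show "\<forall>k \<in> compositions {0..r} K.
      (\<lambda>n. 1 / ((real (n 1) + u - 1) ^ k 0 * (\<Prod>i=1..r. (real (n i) + u) ^ k i))) summable_on ?D"
    unfolding f by blast
  have "((\<lambda>n. \<Sum>k\<in>compositions {0..r} K. f k n) has_sum
          (\<Sum>k\<in>compositions {0..r} K. infsum (f k) ?D)) ?D"
    using * by (intro has_sum_finite_sum has_sum_infsum)
  from has_sum_unique[OF this S] show
    "(\<Sum>k \<in> compositions {0..r} K. \<Sum>\<^sub>\<infinity>n \<in> ?D.
        1 / ((real (n 1) + u - 1) ^ k 0 * (\<Prod>i=1..r. (real (n i) + u) ^ k i))) = 1 / u powi (K - int r)"
    unfolding f .
next
  fix m :: nat
  assume m: "m \<ge> 2"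
  let ?D = "decreasing_tuples r m" and ?A = "{k \<in> compositions {1..r} K. k 1 \<ge> 2}"
  define t where "t k n = 1 / (\<Prod>i=1..r. real (n i) ^ k i)" for k n :: "nat \<Rightarrow> nat"
  \<comment> \<open>\<open>g\<close> is the summed integrand of part (i) with \<open>c = 0\<close>,
    so that \<open>m - 1\<close> takes the place of \<open>u\<close>.\<close>
  define g where "g n = (\<Sum>k\<in>compositions (insert 0 {1..r}) K. summand 0 1 r m k n)" for n
  have split: "(\<Sum>k\<in>compositions (insert 0 {1..r}) K. F k)
      = (\<Sum>k\<in>?A. \<Sum>j=1..<k 1. F (k(0 := j, 1 := k 1 - j)))" for F :: "(nat \<Rightarrow> nat) \<Rightarrow> real"
  proof -
    have "{1..r} = insert 1 {2..r}"
      using assms by auto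
    then show ?thesis
      using sum_compositions_split[of "{2..r}" 0 1 F K] by simp
  qed
  have fin: "finite ?A"
    by (simp add: finite_compositions)
  have less: "(\<Sum>k\<in>?A. (real (k 1) - 1) * t k n) < g n" if "?A \<noteq> {}" "n \<in> ?D" for n
    unfolding g_def split
  proof (rule sum_strict_mono[OF fin that(1)])
    fix k assume "k \<in> ?A"
    then have k: "k 1 \<ge> 2"
      by simp
    \<comment> \<open>The weight \<open>k 1 - 1\<close> counts the ways to split \<open>k 1\<close>
      into two positive parts.\<close>
    then have "(real (k 1) - 1) * t k n = (\<Sum>j=1..<k 1. t k n)"
      by (simp add: of_nat_diff)
    also have "\<dots> < (\<Sum>j=1..<k 1. summand 0 1 r m (k(0 := j, 1 := k 1 - j)) n)"
      unfolding t_def using k that(2) m assms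
      by (intro sum_strict_mono inverse_prod_less_summand) (auto simp: dec_tuples_one simp del: One_nat_def)
    finally show "(real (k 1) - 1) * t k n < (\<Sum>j=1..<k 1. summand 0 1 r m (k(0 := j, 1 := k 1 - j)) n)" .
  qed
  have nonneg: "t k n \<ge> 0" for k n
    unfolding t_def by (simp add: prod_nonneg)
  have S: "(g has_sum 1 / (real m - 1) powi (K - int r)) ?D" if "?A \<noteq> {}"
  proof -
    have "compositions (insert 0 {1..r}) K \<noteq> {}"
    proof
      assume "compositions (insert 0 {1..r}) K = {}"
      \<comment> \<open>With the constant 1, \<open>split\<close> counts compositions: every
        \<open>k\<close> in \<open>?A\<close> contributes at least \<open>j = 1\<close>.\<close>
      then have "(\<Sum>k\<in>?A. \<Sum>j=1..<k 1. 1 :: real) = 0"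
        using split[of "\<lambda>_. 1"] by simp
      moreover have "(\<Sum>k\<in>?A. \<Sum>j=1..<k 1. 1 :: real) > 0"
        using that fin by (intro sum_pos) auto
      ultimately show False
        by simp
    qed
    then have "K \<ge> int r + 1"
      using compositions_nonempty_imp_ge[of "insert 0 {1..r}" _ K] by force
    then show ?thesis
      using sum_summand_has_sum[of 1 r m 0 K] m unfolding g_def dec_tuples_one by simp
  qed
  have *: "t k summable_on ?D" if k: "k \<in> ?A" for k
  proof (rule summable_on_comparison_test)
    show "g summable_on ?D"
      using S k by (intro has_sum_imp_summable) blast
    fix n assume n: "n \<in> ?D"
    \<comment> \<open>The weight is at least 1 because \<open>k 1 \<ge> 2\<close>.\<close>
    have "t k n \<le> (real (k 1) - 1) * t k n"
      using k mult_right_mono[of 1 "real (k 1) - 1" "t k n"] nonneg by simp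
    also have "\<dots> \<le> (\<Sum>k\<in>?A. (real (k 1) - 1) * t k n)"
      using k fin nonneg
      by (intro member_le_sum[where f = "\<lambda>k. (real (k 1) - 1) * t k n"]) auto
    also have "\<dots> \<le> g n"
      using less[OF _ n] k by fastforce
    finally show "t k n \<le> g n" .
  qed (rule nonneg)
  then show "\<forall>k \<in> ?A. (\<lambda>n. 1 / (\<Prod>i=1..r. real (n i) ^ k i)) summable_on ?D"
    unfolding t_def by blast
  have "(\<Sum>k\<in>?A. (real (k 1) - 1) * infsum (t k) ?D) < 1 / (real m - 1) powi (K - int r)"
  \<comment> \<open>For empty \<open>?A\<close>, as happens when \<open>K \<le> r\<close>, the left
    side is 0 and the right side is positive whatever the sign of the exponent.\<close>
  proof (cases "?A = {}")
    case True
    then show ?thesis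
      using m by (simp only: sum.empty) simp
  next
    case False
    \<comment> \<open>Strictness of the infinite sums needs one tuple with a strict inequality; the
      constant tuple \<open>m\<close> serves.\<close>
    have "(\<lambda>i\<in>{1..r}. m) \<in> ?D"
      by (auto simp: decreasing_tuples_def monotone_on_def)
    moreover have "((\<lambda>n. \<Sum>k\<in>?A. (real (k 1) - 1) * t k n) has_sum
        (\<Sum>k\<in>?A. (real (k 1) - 1) * infsum (t k) ?D)) ?D"
      using * by (intro has_sum_finite_sum has_sum_cmult_right has_sum_infsum)
    ultimately show ?thesis
      using less[OF False]
      by (intro has_sum_strict_mono[OF _ S[OF False], where x = "\<lambda>i\<in>{1..r}. m"]) (auto intro: less_imp_le)
  qed
  then show "(\<Sum>k\<in>?A. (real (k 1) - 1) * (\<Sum>\<^sub>\<infinity>n\<in>?D. 1 / (\<Prod>i=1..r. real (n i) ^ k i)))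
      < 1 / (real m - 1) powi (K - int r)"
    unfolding t_def .
qed

end
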